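(* Let $A \in M_n(\mathbb{C})$ be convexoid. Then the multi-valued map $f_A^{-1}\colon F(A) \to \mathbb{C}\mathbb{P}^{n-1}$ is strongly continuous on $F(A)$ (that is, at every point of $F(A)$).
   Context: For $A \in M_n(\mathbb{C})$ the field of values is $F(A) = \{x^*Ax : x \in \mathbb{C}^n,\ x^*x = 1\} \subset \mathbb{C}$. The matrix $A$ is convexoid if $F(A)$ is the convex hull of the spectrum of $A$. Let $\mathbb{C}\mathbb{P}^{n-1}$ be the quotient of the unit sphere $\{x \in \mathbb{C}^n : x^*x=1\}$ by multiplication by unimodular scalars, with a metric inducing the quotient topology. Since $(\omega x)^*A(\omega x) = x^*Ax$ for $|\omega|=1$, the map $f_A(x) = x^*Ax$ (with $x$ a unit representative) is a well-defined map $\mathbb{C}\mathbb{P}^{n-1} \to F(A)$, and $f_A^{-1}$ is the multi-valued map sending $z \in F(A)$ to its preimage $f_A^{-1}(z) = \{x \in \mathbb{C}\mathbb{P}^{n-1} : f_A(x) = z\}$. A multi-valued function $g$ from a metric space $(X,d)$ to a metric space $(Y,\rho)$ is strongly continuous at $x \in X$ if for all $y \in g(x)$: for every $\epsilon>0$ there is $\delta>0$ such that for every $x' \in X$ with $d(x,x')<\delta$ there exists $y' \in g(x')$ with $\rho(y,y')<\epsilon$. Here $X = F(A)$ with the usual metric of $\mathbb{C}$. *)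

theory Defs
  imports "HOL-Analysis.Analysis"
begin

definition star_prod :: "complex^'n \<Rightarrow> complex^'n \<Rightarrow> complex" where
  "star_prod x y = (\<Sum>i\<in>UNIV. cnj (x $ i) * y $ i)"

definition unit_vectors :: "(complex^'n) set" where
  "unit_vectors = {x. star_prod x x = 1}"

definition quad :: "complex^'n^'n \<Rightarrow> complex^'n \<Rightarrow> complex" where
  "quad A x = star_prod x (A *v x)"

definition field_of_values :: "complex^'n^'n \<Rightarrow> complex set" where
  "field_of_values A = {quad A x |x. x \<in> unit_vectors}"

definition spectrum :: "complex^'n^'n \<Rightarrow> complex set" where
  "spectrum A = {l. \<exists>v. v \<noteq> 0 \<and> A *v v = l *s v}"

definition convexoid :: "complex^'n^'n \<Rightarrow> bool" where
  "convexoid A \<longleftrightarrow> field_of_values A = convex hull (spectrum A)"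

definition phase_rel :: "((complex^'n) \<times> (complex^'n)) set" where
  "phase_rel = {(x, y). x \<in> unit_vectors \<and> y \<in> unit_vectors \<and> (\<exists>w. cmod w = 1 \<and> y = w *s x)}"

definition proj_space :: "(complex^'n) set set" where
  "proj_space = unit_vectors // phase_rel"

definition proj_class :: "complex^'n \<Rightarrow> (complex^'n) set" where
  "proj_class x = phase_rel `` {x}"

text \<open>A metric space on the set of phase classes whose topology is the quotient topology
  of the unit sphere.\<close>

definition quotient_metric :: "(complex^'n) set metric \<Rightarrow> bool" where
  "quotient_metric Y \<longleftrightarrow> mspace Y = proj_space \<and>
     quotient_map (top_of_set unit_vectors) (mtopology_of Y) proj_class"

text \<open>\<open>quad A\<close> is constant on each class (\<open>fov_map_proj_class\<close> below), so \<open>the_elem\<close> picks its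
  single value there.\<close>

definition fov_map :: "complex^'n^'n \<Rightarrow> (complex^'n) set \<Rightarrow> complex" where
  "fov_map A p = the_elem (quad A ` p)"

definition fov_inverse :: "complex^'n^'n \<Rightarrow> complex \<Rightarrow> (complex^'n) set set" where
  "fov_inverse A z = {p \<in> proj_space. fov_map A p = z}"

text \<open>A multi-valued function from \<open>X\<close> to \<open>Y\<close> is a set-valued function whose values at the points
  of \<open>X\<close> are subsets of \<open>Y\<close>.\<close>

definition strongly_continuous_at ::
    "'a metric \<Rightarrow> 'b metric \<Rightarrow> ('a \<Rightarrow> 'b set) \<Rightarrow> 'a \<Rightarrow> bool" where
  "strongly_continuous_at X Y g x \<longleftrightarrow>
     (\<forall>y\<in>g x. \<forall>e>0. \<exists>d>0. \<forall>x'\<in>mspace X. mdist X x x' < d \<longrightarrow>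
        (\<exists>y'\<in>g x'. mdist Y y y' < e))"

lemma star_prod_scale: "cmod w = 1 \<Longrightarrow> star_prod (w *s x) (w *s y) = star_prod x y"
proof -
  assume "cmod w = 1"
  then have "cnj w * w = 1"
    by (metis complex_norm_square mult.commute of_real_1 power_one)
  then have "cnj (w * a) * (w * b) = cnj a * b" for a b
    by (metis complex_cnj_mult mult.assoc mult.left_commute mult_1)
  then show ?thesis
    by (simp only: star_prod_def vector_smult_component)
qed

lemma quad_scale: "cmod w = 1 \<Longrightarrow> quad A (w *s x) = quad A x"
  by (simp add: quad_def vector_scalar_commute star_prod_scale)

lemma in_proj_class: "x \<in> unit_vectors \<Longrightarrow> x \<in> proj_class x"
  by (auto simp: proj_class_def phase_rel_def intro: exI[of _ 1])

lemma fov_map_proj_class: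
  assumes "x \<in> unit_vectors"
  shows "fov_map A (proj_class x) = quad A x"
proof -
  have "quad A ` proj_class x = {quad A x}"
    using in_proj_class[OF assms] by (auto simp: proj_class_def phase_rel_def quad_scale)
  then show ?thesis
    by (simp add: fov_map_def)
qed

lemma proj_space_eq: "proj_space = proj_class ` unit_vectors"
  by (auto simp: proj_space_def proj_class_def quotient_def)

lemma field_of_values_eq: "field_of_values A = fov_map A ` proj_space"
  by (auto simp: field_of_values_def proj_space_eq fov_map_proj_class image_iff)

lemma star_prod_self: "star_prod x x = of_real ((norm x)\<^sup>2)"
  by (simp add: star_prod_def norm_vec_def L2_set_def sum_nonneg complex_norm_square mult.commute
      del: of_real_power)

lemma unit_vectors_eq_sphere: "unit_vectors = sphere 0 1"
  by (auto simp: unit_vectors_def star_prod_self abs_square_eq_1 simp flip: of_real_power)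

text \<open>Metrics as required by \<open>quotient_metric\<close> exist: identify the class of \<open>x\<close> with the rank-one
  projection \<open>x x\<^sup>*\<close>.\<close>

lemma quotient_metric_exists: "\<exists>Y :: (complex^'n) set metric. quotient_metric Y"
proof -
  define P :: "complex^'n \<Rightarrow> complex^'n^'n" where "P x = (\<chi> i j. x $ i * cnj (x $ j))" for x
  define h :: "(complex^'n) set \<Rightarrow> complex^'n^'n" where "h p = the_elem (P ` p)" for p
  have P_scale: "P (w *s x) = P x" if "cmod w = 1" for w x
  proof -
    have "w * cnj w = 1"
      using that by (metis complex_norm_square of_real_1 power_one)
    then have "(w * a) * cnj (w * b) = a * cnj b" for a b
      by (metis complex_cnj_mult mult.assoc mult.left_commute mult_1)
    then show ?thesis by (simp add: P_def vec_eq_iff)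
  qed
  have h: "h (proj_class x) = P x" if "x \<in> unit_vectors" for x
  proof -
    have "P ` proj_class x = {P x}"
      using in_proj_class[OF that] by (auto simp: proj_class_def phase_rel_def P_scale)
    then show ?thesis by (simp add: h_def)
  qed
  have P_vec: "P x *v y = star_prod x y *s x" for x y
    by (simp add: P_def star_prod_def matrix_vector_mult_def vec_eq_iff sum_distrib_left
        mult.commute mult.left_commute)
  have equiv: "equiv unit_vectors (phase_rel :: ((complex^'n) \<times> (complex^'n)) set)"
  proof (rule equivI)
    show "refl_on unit_vectors (phase_rel :: ((complex^'n) \<times> (complex^'n)) set)"
      by (auto simp: refl_on_def phase_rel_def intro: exI[of _ 1])
    show "sym (phase_rel :: ((complex^'n) \<times> (complex^'n)) set)"
    proof (rule symI)
      fix x y :: "complex^'n"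
      assume "(x, y) \<in> phase_rel"
      then obtain w where xy: "x \<in> unit_vectors" "y \<in> unit_vectors"
        and w: "cmod w = 1" "y = w *s x"
        by (auto simp: phase_rel_def)
      have "x = inverse w *s y"
        using w by (cases "w = 0") (simp_all add: vector_smult_assoc)
      moreover have "cmod (inverse w) = 1"
        using w by (simp add: norm_inverse)
      ultimately show "(y, x) \<in> phase_rel"
        unfolding phase_rel_def using xy by blast
    qed
    show "trans (phase_rel :: ((complex^'n) \<times> (complex^'n)) set)"
    proof (rule transI)
      fix x y z :: "complex^'n"
      assume "(x, y) \<in> phase_rel" "(y, z) \<in> phase_rel"
      then obtain v w where "x \<in> unit_vectors" "z \<in> unit_vectors" "cmod v = 1" "cmod w = 1"
        "z = (w * v) *s x"
        by (auto simp: phase_rel_def vector_smult_assoc)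
      moreover from this have "cmod (w * v) = 1"
        by (simp add: norm_mult)
      ultimately show "(x, z) \<in> phase_rel"
        unfolding phase_rel_def by blast
    qed
    show "(phase_rel :: ((complex^'n) \<times> (complex^'n)) set) \<subseteq> unit_vectors \<times> unit_vectors"
      by (auto simp: phase_rel_def)
  qed
  have inj: "proj_class x = proj_class y"
    if x: "x \<in> unit_vectors" and y: "y \<in> unit_vectors" and eq: "P x = P y" for x y
  proof -
    define w where "w = star_prod x y"
    have "y = w *s x"
      using P_vec[of y y] P_vec[of x y] eq y by (simp add: w_def unit_vectors_def)
    moreover have "cmod w = 1"
    proof -
      have "star_prod y y = (cnj w * w) * star_prod x x"
        by (simp add: \<open>y = w *s x\<close> star_prod_def sum_distrib_left mult_ac)
      then have "cnj w * w = 1"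
        using x y unfolding unit_vectors_def by simp
      then have "cmod w * cmod w = 1"
        by (metis complex_mod_cnj norm_mult norm_one)
      then show ?thesis
        by (metis norm_ge_zero real_sqrt_abs2 abs_of_nonneg real_sqrt_one)
    qed
    ultimately have "(x, y) \<in> phase_rel"
      using x y by (auto simp: phase_rel_def)
    then show ?thesis
      unfolding proj_class_def by (rule equiv_class_eq[OF equiv])
  qed
  have in_proj_space: "proj_class x \<in> proj_space" if "x \<in> unit_vectors" for x :: "complex^'n"
    using that by (simp add: proj_space_eq)
  define d where "d p q = dist (h p) (h q)" for p q
  interpret Metric_space proj_space d
  proof
    show "d p q = 0 \<longleftrightarrow> p = q" if "p \<in> proj_space" "q \<in> proj_space" for p q
    proof -
      obtain x y where "x \<in> unit_vectors" "y \<in> unit_vectors" "p = proj_class x" "q = proj_class y"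
        using \<open>p \<in> proj_space\<close> \<open>q \<in> proj_space\<close> unfolding proj_space_eq by blast
      then show ?thesis
        using inj[of x y] h[of x] h[of y] by (auto simp: d_def)
    qed
  qed (simp_all add: d_def dist_commute dist_triangle)
  have cont: "continuous_on unit_vectors P"
    unfolding P_def by (intro continuous_intros)
  have "continuous_map (top_of_set unit_vectors) mtopology proj_class"
    unfolding continuous_map_to_metric
  proof (intro ballI allI impI)
    fix x :: "complex^'n" and e :: real
    assume "x \<in> topspace (top_of_set unit_vectors)" and "e > 0"
    then have x: "x \<in> unit_vectors" by simp
    define U where "U = {y \<in> unit_vectors. P y \<in> ball (P x) e}"
    have "openin (top_of_set unit_vectors) U"
      using continuous_openin_preimage_gen[OF cont open_ball[of "P x" e]]
      by (simp add: U_def vimage_def Int_def del: mem_ball)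
    moreover have "x \<in> U" using x \<open>e > 0\<close> by (simp add: U_def)
    moreover have "\<forall>y\<in>U. proj_class y \<in> mball (proj_class x) e"
      using x by (auto simp: U_def in_mball d_def h in_proj_space)
    ultimately show "\<exists>U. openin (top_of_set unit_vectors) U \<and> x \<in> U \<and>
        (\<forall>y\<in>U. proj_class y \<in> mball (proj_class x) e)"
      by blast
  qed
  moreover have "compact_space (top_of_set (unit_vectors :: (complex^'n) set))"
    by (simp add: unit_vectors_eq_sphere compact_space_subtopology)
  ultimately have "quotient_map (top_of_set unit_vectors) mtopology proj_class"
    by (intro continuous_imp_quotient_map Hausdorff_space_mtopology) (simp_all add: proj_space_eq[symmetric])
  then have "quotient_metric (metric (proj_space, d))"
    by (simp add: quotient_metric_def)
  then show ?thesis ..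
qed

end

theory Submission
  imports Defs
begin

text \<open>
  Two facts combine. First, a quantitative form of the Toeplitz-Hausdorff theorem: for unit vectors
  \<open>x\<close>, \<open>y\<close> and \<open>t \<in> [0, 1]\<close>, the point \<open>(1 - t) f(x) + t f(y)\<close> is attained at a unit vector within
  \<open>4 sqrt t\<close> of \<open>x\<close>; the bound does not depend on \<open>y\<close>. Second, the field of values of a convexoid
  matrix is a polygon, and in a polyhedron \<open>P\<close> every point \<open>z'\<close> close enough to \<open>z\<close> has the form
  \<open>(1 - t) z + t w\<close> with \<open>w \<in> P\<close> and \<open>t\<close> as small as desired.
\<close>

section \<open>Polyhedra and the finiteness of the spectrum\<close>

text \<open>Checked on one half-space at a time, finitely many being involved. A half-space with
  \<open>z\<close> on its boundary is a cone with apex \<open>z\<close>, so dilation from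
  \<open>z\<close> by \<open>1 / t\<close> preserves it. If \<open>z\<close> is interior, continuity
  of the dilation suffices.\<close>

lemma polyhedron_extend_segment:
  fixes P :: "'a::euclidean_space set"
  assumes "polyhedron P" "z \<in> P" "t > 0"
  shows "\<forall>\<^sub>F z' in nhds z. z' \<in> P \<longrightarrow> z + (1 / t) *\<^sub>R (z' - z) \<in> P"
proof -
  obtain F where F: "finite F" "P = \<Inter>F" "\<And>h. h \<in> F \<Longrightarrow> \<exists>a b. h = {x. a \<bullet> x \<le> b}"
    using assms(1) unfolding polyhedron_def by metis
  have "\<forall>\<^sub>F z' in nhds z. z' \<in> h \<longrightarrow> z + (1 / t) *\<^sub>R (z' - z) \<in> h" if "h \<in> F" for h
  proof -
    obtain a b where h: "h = {x. a \<bullet> x \<le> b}" using F(3) \<open>h \<in> F\<close> by blast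
    have zb: "a \<bullet> z \<le> b" using assms(2) F(2) \<open>h \<in> F\<close> h by blast
    show ?thesis
    proof (cases "a \<bullet> z = b")
      case True
      have "a \<bullet> z + (1 / t) * (a \<bullet> z' - a \<bullet> z) \<le> b" if "a \<bullet> z' \<le> b" for z'
        using that \<open>t > 0\<close> True by (simp add: divide_simps)
      then show ?thesis
        by (simp add: h inner_add_right inner_diff_right del: times_divide_eq_left)
    next
      case False
      have "((\<lambda>z'. a \<bullet> (z + (1 / t) *\<^sub>R (z' - z))) \<longlongrightarrow> a \<bullet> (z + (1 / t) *\<^sub>R (z - z))) (nhds z)"
        by (intro tendsto_intros filterlim_ident)
      then have "\<forall>\<^sub>F z' in nhds z. a \<bullet> (z + (1 / t) *\<^sub>R (z' - z)) < b"
        by (rule order_tendstoD) (use False zb in simp)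
      then show ?thesis
        by (rule eventually_mono) (simp add: h)
    qed
  qed
  then have "\<forall>\<^sub>F z' in nhds z. \<forall>h\<in>F. z' \<in> h \<longrightarrow> z + (1 / t) *\<^sub>R (z' - z) \<in> h"
    using F(1) by (simp add: eventually_ball_finite)
  then show ?thesis
    by (rule eventually_mono) (auto simp: F(2))
qed

text \<open>The eigenvalues are the roots of the characteristic polynomial. They are bounded by an
  operator bound of \<open>A\<close>, so some number is not a root and the polynomial is
  nonzero.\<close>

lemma finite_spectrum: "finite (spectrum (A :: complex^'n^'n))"
proof -
  define p where "p = det (\<chi> i j. [:A $ i $ j:] - (if i = j then [:0, 1:] else 0))"
  have poly_p: "poly p l = det (A - mat l)" for l
    by (auto simp: p_def det_def poly_sum poly_prod mat_def intro!: sum.cong prod.cong)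
  have spec: "l \<in> spectrum A \<longleftrightarrow> det (A - mat l) = 0" for l
  proof -
    have "mat l *v v = l *s v" for v :: "complex^'n"
      by (simp add: vec_eq_iff mat_def matrix_vector_mult_def if_distrib if_distribR cong: if_cong)
    then have "(A - mat l) *v v = A *v v - l *s v" for v
      by (simp add: matrix_vector_mult_diff_rdistrib)
    then have "l \<in> spectrum A \<longleftrightarrow> (\<exists>v. v \<noteq> 0 \<and> (A - mat l) *v v = 0)"
      by (simp add: spectrum_def)
    also have "\<dots> \<longleftrightarrow> det (A - mat l) = 0"
      using matrix_left_invertible_ker[of "A - mat l"] invertible_det_nz[of "A - mat l"]
      by (metis invertible_def matrix_left_right_inverse)
    finally show ?thesis .
  qed
  obtain K where K: "\<And>v. norm (A *v v) \<le> norm v * K"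
    using bounded_linear.bounded[OF matrix_vector_mul_bounded_linear[of A]] by blast
  have "cmod l \<le> K" if l: "l \<in> spectrum A" for l
  proof -
    obtain v where "v \<noteq> 0" "A *v v = l *s v" using l by (auto simp: spectrum_def)
    moreover have "norm (l *s v) = cmod l * norm v"
      by (simp add: norm_vec_def norm_mult L2_set_right_distrib)
    ultimately have "cmod l * norm v \<le> K * norm v"
      using K[of v] by (simp add: mult.commute)
    then show ?thesis using \<open>v \<noteq> 0\<close> by simp
  qed
  then have "of_real (\<bar>K\<bar> + 1) \<notin> spectrum A"
    by (metis abs_ge_self abs_ge_zero add_nonneg_nonneg norm_of_real abs_of_nonneg
        less_add_one not_le order.trans zero_le_one)
  then have "p \<noteq> 0"
    using spec poly_p by (metis poly_0)
  then show ?thesis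
    using poly_roots_finite[of p] by (simp add: poly_p flip: spec)
qed

section \<open>Sesquilinear algebra and the quantitative Toeplitz-Hausdorff theorem\<close>

lemma star_prod_add_left: "star_prod (x + y) z = star_prod x z + star_prod y z"
  by (simp add: star_prod_def sum.distrib algebra_simps)

lemma star_prod_add_right: "star_prod x (y + z) = star_prod x y + star_prod x z"
  by (simp add: star_prod_def sum.distrib algebra_simps)

lemma star_prod_scaleR_left: "star_prod (r *\<^sub>R x) y = of_real r * star_prod x y"
  by (simp add: star_prod_def sum_distrib_left scaleR_conv_of_real[of _ "_ :: complex"] mult_ac)

lemma star_prod_scaleR_right: "star_prod x (r *\<^sub>R y) = of_real r * star_prod x y"
  by (simp add: star_prod_def sum_distrib_left scaleR_conv_of_real[of _ "_ :: complex"] mult_ac)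

lemma star_prod_smult_left: "star_prod (w *s x) y = cnj w * star_prod x y"
  by (simp add: star_prod_def sum_distrib_left mult_ac)

lemma star_prod_smult_right: "star_prod x (w *s y) = w * star_prod x y"
  by (simp add: star_prod_def sum_distrib_left mult_ac)

lemmas star_prod_simps = star_prod_add_left star_prod_add_right star_prod_scaleR_left
  star_prod_scaleR_right star_prod_smult_left star_prod_smult_right

lemma matrix_vector_mult_scaleR_complex: "(A :: complex^'n^'n) *v (r *\<^sub>R x) = r *\<^sub>R (A *v x)"
  by (rule linear_scale[OF matrix_vector_mul_linear])

lemma quad_scaleR: "quad A (r *\<^sub>R x) = of_real (r\<^sup>2) * quad A x"
  by (simp add: quad_def matrix_vector_mult_scaleR_complex star_prod_simps power2_eq_square)

text \<open>Serves to make the cross term of a sesquilinear form real and nonnegative by rotating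
  one argument. Since \<open>cnj w * r\<close> and \<open>w * cnj r\<close> have opposite imaginary
  parts, it is enough that \<open>w * (q - cnj r)\<close> is real; passing from \<open>w\<close> to
  \<open>- w\<close> then corrects the sign.\<close>

lemma exists_phase_nonneg:
  fixes q r :: complex
  obtains w c where "cmod w = 1" "c \<ge> 0" "w * q + cnj w * r = of_real c"
proof -
  define d where "d = q - cnj r"
  define v where "v = (if d = 0 then 1 else cnj (sgn d))"
  have v: "cmod v = 1" by (simp add: v_def norm_sgn)
  have "v * d = of_real (cmod d)"
    using complex_norm_square[of d]
    by (simp add: v_def sgn_eq field_simps power2_eq_square)
  moreover have "Im (v * q + cnj v * r) = Im (v * d)"
    by (simp add: d_def algebra_simps)
  ultimately have "Im (v * q + cnj v * r) = 0" by simp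
  then have eq: "v * q + cnj v * r = of_real (Re (v * q + cnj v * r))"
    by (simp add: complex_eq_iff)
  show thesis
  proof (cases "Re (v * q + cnj v * r) \<ge> 0")
    case True
    then show thesis using v eq that by blast
  next
    case False
    then show thesis
      using that[of "- v" "- Re (v * q + cnj v * r)"] v eq
      by (simp add: algebra_simps complex_eq_iff)
  qed
qed

text \<open>The vector is found on the segment from \<open>x\<close> to a rotated copy of
  \<open>y\<close>, at a parameter \<open>s \<le> sqrt t\<close>, and then normalised. Moving along
  the segment costs at most \<open>2 * s\<close>, normalising at most \<open>2 * s\<close>
  more.\<close>

lemma quantitative_Toeplitz_Hausdorff:
  assumes x: "norm x = 1" and y: "norm y = 1" and t: "0 \<le> t" "t \<le> 1"
  obtains x' where "norm x' = 1"
    and "quad A x' = (1 - of_real t) * quad A x + of_real t * quad A y"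
    and "dist x x' \<le> 4 * sqrt t"
proof (cases "quad A x = quad A y")
  case True
  then show thesis using that[of x] x t by (simp add: algebra_simps)
next
  case False
  define a where "a = quad A x"
  define k where "k = quad A y - a"
  have k: "k \<noteq> 0" using False by (simp add: k_def a_def)
  \<comment> \<open>The form of \<open>A - a I\<close> divided by \<open>k\<close>: the affine map
    sending \<open>quad A x\<close> to 0 and \<open>quad A y\<close> to 1 turns the target value
    into the real number \<open>t\<close>.\<close>
  define B where "B u v = (star_prod u (A *v v) - a * star_prod u v) / k" for u v
  have B_self: "B v v = (quad A v - a * of_real ((norm v)\<^sup>2)) / k" for v
    by (simp add: B_def quad_def star_prod_self)
  \<comment> \<open>For this phase the form \<open>B v v\<close> is real on the segment from \<open>x\<close> to \<open>w *s y\<close>, and at parameter \<open>s\<close>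
    it is at least \<open>s\<^sup>2\<close>, so the value \<open>t\<close> is already attained at some \<open>s \<le> sqrt t\<close>.\<close>
  obtain w c where w: "cmod w = 1" and c: "c \<ge> 0" "w * B x y + cnj w * B y x = of_real c"
    using exists_phase_nonneg .
  define y' where "y' = w *s y"
  have qy': "quad A y' = quad A y" by (simp add: y'_def quad_scale w)
  have y': "norm y' = 1"
    by (simp add: y'_def norm_vec_def norm_mult w) (use y in \<open>simp add: norm_vec_def\<close>)
  have cross: "B x y' + B y' x = of_real c"
  proof -
    have "B x y' = w * B x y" "B y' x = cnj w * B y x"
      using k by (simp_all add: B_def y'_def vector_scalar_commute star_prod_simps field_simps)
    then show ?thesis using c by simp
  qed
  have Bx: "B x x = 0" using x by (simp add: B_self a_def)
  have By: "B y' y' = 1" using y' k by (simp add: B_self qy' k_def)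
  define v where "v s = (1 - s) *\<^sub>R x + s *\<^sub>R y'" for s
  define g where "g s = s\<^sup>2 + s * (1 - s) * c" for s
  have Bv: "B (v s) (v s) = of_real (g s)" for s
  proof -
    have "B (p *\<^sub>R x + q *\<^sub>R y') (p *\<^sub>R x + q *\<^sub>R y') =
        of_real (p\<^sup>2) * B x x + of_real (q\<^sup>2) * B y' y' + of_real (q * p) * (B x y' + B y' x)" for p q
      using k by (simp add: B_def matrix_vector_right_distrib star_prod_simps
          matrix_vector_mult_scaleR_complex field_simps power2_eq_square)
    then show ?thesis by (simp add: v_def Bx By cross g_def)
  qed
  have nv: "norm (v s) \<le> 1" if "0 \<le> s" "s \<le> 1" for s
    unfolding v_def using norm_triangle_ineq[of "(1 - s) *\<^sub>R x" "s *\<^sub>R y'"] that x y' by simp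
  have g_ge: "s\<^sup>2 \<le> g s" if "0 \<le> s" "s \<le> 1" for s
    using that c by (simp add: g_def)
  have v_nz: "v s \<noteq> 0" if "0 \<le> s" "s \<le> 1" for s
  proof
    assume v0: "v s = 0"
    then have "g s = 0" using Bv[of s] by (simp add: B_def star_prod_def)
    then have "s = 0" using g_ge[OF that] by simp
    then show False using v0 x by (simp add: v_def)
  qed
  \<comment> \<open>The value of the form at the normalised vector \<open>v s\<close>.\<close>
  define h where "h s = g s / (norm (v s))\<^sup>2" for s
  have sqrt_t: "0 \<le> sqrt t" "sqrt t \<le> 1" using t by simp_all
  have "\<exists>s\<ge>0. s \<le> sqrt t \<and> h s = t"
  proof (rule IVT')
    show "h 0 \<le> t" using t by (simp add: h_def g_def)
    have "t * (norm (v (sqrt t)))\<^sup>2 \<le> t * 1"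
      using nv[OF sqrt_t] t by (intro mult_left_mono) (simp_all add: power_le_one)
    also have "\<dots> \<le> g (sqrt t)" using g_ge[OF sqrt_t] t by simp
    finally show "t \<le> h (sqrt t)"
      using v_nz[OF sqrt_t] by (simp add: h_def pos_le_divide_eq)
    show "continuous_on {0..sqrt t} h"
      unfolding h_def g_def v_def
      by (intro continuous_intros)
        (metis v_def v_nz sqrt_t(2) atLeastAtMost_iff order_trans norm_eq_zero power_eq_0_iff)
  qed (rule sqrt_t)
  then obtain s where s: "0 \<le> s" "s \<le> sqrt t" and hs: "h s = t" by blast
  define n where "n = norm (v s)"
  have n: "n > 0" "n \<le> 1" using v_nz[of s] nv[of s] s sqrt_t by (auto simp: n_def)
  have "g s = t * n\<^sup>2" using hs n by (simp add: h_def n_def field_simps)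
  then have "quad A (v s) - a * of_real (n\<^sup>2) = k * of_real (t * n\<^sup>2)"
    using Bv[of s] k by (simp add: B_self n_def field_simps)
  then have qv: "quad A (v s) = (a + k * of_real t) * of_real (n\<^sup>2)"
    by (simp add: algebra_simps)
  have vx: "norm (v s - x) \<le> 2 * s"
  proof -
    have "v s - x = s *\<^sub>R (y' - x)" by (simp add: v_def algebra_simps)
    moreover have "norm (y' - x) \<le> 2" using norm_triangle_ineq4[of y' x] x y' by simp
    ultimately show ?thesis using s by (simp add: mult.commute mult_left_mono)
  qed
  show thesis
  proof (rule that)
    show "norm ((1 / n) *\<^sub>R v s) = 1" using n by (simp add: n_def)
    show "quad A ((1 / n) *\<^sub>R v s) = (1 - of_real t) * quad A x + of_real t * quad A y"
      using n unfolding quad_scaleR qv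
      by (simp add: k_def a_def power_divide algebra_simps)
    have "(1 / n) *\<^sub>R v s - v s = (1 / n - 1) *\<^sub>R v s" by (simp add: algebra_simps)
    then have "norm ((1 / n) *\<^sub>R v s - v s) = \<bar>1 / n - 1\<bar> * n" by (simp add: n_def)
    also have "\<dots> = 1 - n" using n by (simp add: field_simps)
    \<comment> \<open>As \<open>norm x = 1\<close>, the loss of norm \<open>1 - n\<close> is at most
      the distance from \<open>x\<close> to \<open>v s\<close>.\<close>
    also have "\<dots> \<le> 2 * s"
      using vx norm_triangle_ineq2[of x "v s"] x by (simp add: n_def norm_minus_commute)
    finally have "dist x ((1 / n) *\<^sub>R v s) \<le> 4 * s"
      using vx dist_triangle[of x "(1 / n) *\<^sub>R v s" "v s"]
      by (simp add: dist_norm norm_minus_commute)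
    then show "dist x ((1 / n) *\<^sub>R v s) \<le> 4 * sqrt t" using s by simp
  qed
qed

section \<open>Passage to projective space and conclusion\<close>

text \<open>Quotient maps are continuous; this is the epsilon-delta form, which carries estimates on
  the unit sphere over to classes.\<close>

lemma quotient_metric_proj_class_continuous:
  assumes Y: "quotient_metric Y" and x: "x \<in> unit_vectors" and e: "e > 0"
  obtains r where "r > 0"
    and "\<And>x'. x' \<in> unit_vectors \<Longrightarrow> dist x x' < r \<Longrightarrow> mdist Y (proj_class x) (proj_class x') < e"
proof -
  have mY: "mspace Y = proj_space" using Y by (simp add: quotient_metric_def)
  interpret Metric_space "mspace Y" "mdist Y" by (rule Metric_space_mspace_mdist)
  have "continuous_map (top_of_set unit_vectors) mtopology proj_class"
    using Y quotient_imp_continuous_map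
    by (auto simp: quotient_metric_def mtopology_of_def)
  then obtain U where U: "openin (top_of_set unit_vectors) U" "x \<in> U"
      "\<forall>y\<in>U. proj_class y \<in> mball (proj_class x) e"
    using x e unfolding continuous_map_to_metric by force
  then obtain r where "r > 0" "\<And>x'. x' \<in> unit_vectors \<Longrightarrow> dist x' x < r \<Longrightarrow> x' \<in> U"
    unfolding openin_euclidean_subtopology_iff by blast
  then show thesis
    using that U(3) by (force simp: dist_commute)
qed

theorem corollary5:
  fixes A :: "complex^'n^'n" and Y :: "(complex^'n) set metric"
  assumes "convexoid A"
    and "quotient_metric Y"
  shows "\<forall>z\<in>field_of_values A.
    strongly_continuous_at (submetric euclidean_metric (field_of_values A)) Y (fov_inverse A) z"
proof
  let ?F = "field_of_values A"
  fix z assume z: "z \<in> ?F"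
  have "polyhedron ?F"
    using assms(1) finite_spectrum[of A] by (simp add: convexoid_def polyhedron_convex_hull)
  show "strongly_continuous_at (submetric euclidean_metric ?F) Y (fov_inverse A) z"
    unfolding strongly_continuous_at_def
  proof (intro ballI allI impI)
    fix p and e :: real
    assume p: "p \<in> fov_inverse A z" and "e > 0"
    then obtain x where x: "x \<in> unit_vectors" "p = proj_class x" "quad A x = z"
      by (auto simp: fov_inverse_def proj_space_eq fov_map_proj_class)
    obtain r where r: "r > 0"
        "\<And>x'. x' \<in> unit_vectors \<Longrightarrow> dist x x' < r \<Longrightarrow> mdist Y p (proj_class x') < e"
      using quotient_metric_proj_class_continuous[OF assms(2) x(1) \<open>e > 0\<close>] x(2) by metis
    \<comment> \<open>The divisor 5 makes the bound \<open>4 * sqrt t\<close> strictly smaller than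
      \<open>r\<close>; the minimum keeps \<open>t\<close> in the unit interval.\<close>
    define t where "t = min 1 ((r / 5)\<^sup>2)"
    have t: "0 < t" "t \<le> 1" using r by (simp_all add: t_def)
    have "sqrt t \<le> r / 5"
      using r by (intro real_le_lsqrt) (simp_all add: t_def)
    then have tr: "4 * sqrt t < r" using r by simp
    obtain d where d: "d > 0"
        "\<And>z'. dist z' z < d \<Longrightarrow> z' \<in> ?F \<Longrightarrow> z + (1 / t) *\<^sub>R (z' - z) \<in> ?F"
      using polyhedron_extend_segment[OF \<open>polyhedron ?F\<close> z t(1)]
      unfolding eventually_nhds_metric by blast
    have "\<exists>p'\<in>fov_inverse A z'. mdist Y p p' < e" if z': "z' \<in> ?F" "dist z z' < d" for z'
    proof -
      \<comment> \<open>Chosen so that \<open>z' = (1 - t) z + t * quad A y\<close>. This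
        \<open>y\<close> varies with \<open>z'\<close>, but the bound on \<open>dist x x'\<close> is
        uniform in \<open>y\<close>.\<close>
      obtain y where y: "y \<in> unit_vectors" "quad A y = z + (1 / t) *\<^sub>R (z' - z)"
        using d(2)[of z'] z' by (auto simp: field_of_values_def dist_commute)
      obtain x' where x': "norm x' = 1" "dist x x' \<le> 4 * sqrt t"
          "quad A x' = (1 - of_real t) * quad A x + of_real t * quad A y"
        using quantitative_Toeplitz_Hausdorff[of x y t A] x(1) y(1) t
        by (auto simp: unit_vectors_eq_sphere)
      have "x' \<in> unit_vectors" using x' by (simp add: unit_vectors_eq_sphere)
      moreover have "quad A x' = z'"
        using t by (simp add: x' x(3) y(2) scaleR_conv_of_real field_simps)
      ultimately show ?thesis
        using r(2)[of x'] x'(2) tr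
        by (auto simp: fov_inverse_def proj_space_eq fov_map_proj_class intro!: bexI[of _ "proj_class x'"])
    qed
    then show "\<exists>d>0. \<forall>z'\<in>mspace (submetric euclidean_metric ?F).
        mdist (submetric euclidean_metric ?F) z z' < d \<longrightarrow> (\<exists>p'\<in>fov_inverse A z'. mdist Y p p' < e)"
      using d(1) by auto
  qed
qed

end
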